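(* Let $f : \mathbb{N} \rightarrow \mathbb{N}$ be a nondecreasing function such that: (a) there exist $c,\epsilon > 0$ such that for all $n \in \mathbb{N}$, $$f(n) \geq c\, n \log(n) (\log\log n)^{1+\epsilon};$$ (b) there exist $C_1, C_2 > 1$ such that for all $n \in \mathbb{N}$, $C_1 f(n) \leq f(C_2 n)$. Then there exist a residually finite group $G$, generated by a finite set $S$, and constants $C_1'', C_2'' > 0$ such that for all $n \in \mathbb{N}$, $$f(C_1'' n) \leq \mathcal{D}_G^S(n) \leq f(C_2'' n).$$
   Context: $\mathbb{N}=\{1,2,3,\dots\}$ and $\log$ is the natural logarithm. For a function $f:\mathbb{N}\to\mathbb{N}$ and a real $x\in(0,\infty)$ that is not an integer, $f(x)$ means $f(\lceil x\rceil)$. The factor $(\log\log n)^{1+\epsilon}$ is read as $0$ for $n\in\{1,2\}$. A group $G$ is residually finite if for every nontrivial $g\in G$ there is a finite-index subgroup of $G$ not containing $g$. For $G$ generated by a finite set $S$, let $B_S(n)=\{s_1\cdots s_m : 0\le m\le n,\ s_i\in S\cup S^{-1}\}$. The depth of a nontrivial $g\in G$ is the minimal index of a finite-index (not necessarily normal) subgroup of $G$ not containing $g$. The divisibility function $\mathcal{D}_G^S:\mathbb{N}\to\mathbb{N}$ is defined by letting $\mathcal{D}_G^S(n)$ be the maximal depth among the nontrivial elements of $B_S(n)$. *)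

theory Defs
  imports Complex_Main "HOL-Algebra.Coset" "HOL-Algebra.Generated_Groups"
begin

text \<open>
  The positive integers are rendered as the natural numbers \<open>n \<ge> 1\<close>; functions on them have
  type \<^typ>\<open>nat \<Rightarrow> nat\<close> and their value at \<open>0\<close> is never used.
\<close>

definition at_real :: "(nat \<Rightarrow> nat) \<Rightarrow> real \<Rightarrow> nat" where
  "at_real f x = f (nat \<lceil>x\<rceil>)"

definition finite_index_subgroup :: "'a set \<Rightarrow> ('a, 'b) monoid_scheme \<Rightarrow> bool" where
  "finite_index_subgroup H G \<longleftrightarrow> subgroup H G \<and> finite (rcosets\<^bsub>G\<^esub> H)"

definition residually_finite :: "('a, 'b) monoid_scheme \<Rightarrow> bool" where
  "residually_finite G \<longleftrightarrow>
     (\<forall>g \<in> carrier G - {\<one>\<^bsub>G\<^esub>}. \<exists>H. finite_index_subgroup H G \<and> g \<notin> H)"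

definition word_ball :: "('a, 'b) monoid_scheme \<Rightarrow> 'a set \<Rightarrow> nat \<Rightarrow> 'a set" where
  "word_ball G S n =
     {foldr (\<otimes>\<^bsub>G\<^esub>) ws \<one>\<^bsub>G\<^esub> | ws. length ws \<le> n \<and> set ws \<subseteq> S \<union> m_inv G ` S}"

text \<open>Meaningful for nontrivial \<open>g\<close> in a residually finite group.\<close>

definition depth :: "('a, 'b) monoid_scheme \<Rightarrow> 'a \<Rightarrow> nat" where
  "depth G g =
     (LEAST k. \<exists>H. finite_index_subgroup H G \<and> g \<notin> H \<and> k = card (rcosets\<^bsub>G\<^esub> H))"

text \<open>
  The maximum ranges over a finite set if \<open>S\<close> is finite. That set is empty, and the value
  unspecified, only if \<open>n = 0\<close> or \<open>S\<close> generates the trivial group; for trivial \<open>G\<close> the value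
  does not depend on \<open>n\<close>.
\<close>

definition divisibility_fun :: "('a, 'b) monoid_scheme \<Rightarrow> 'a set \<Rightarrow> nat \<Rightarrow> nat" where
  "divisibility_fun G S n = Max (depth G ` (word_ball G S n - {\<one>\<^bsub>G\<^esub>}))"

end

theory Submission
  imports Defs "HOL-Combinatorics.Transposition" "HOL-Library.Countable_Set"
begin

text \<open>
  For each \<open>k\<close> let \<open>B\<close> rotate a cycle of length \<open>d\<^sub>k = 2 ^ e\<^sub>k\<close> and
  hang a copy of \<open>{0, 1, 2}\<close> over each position; let \<open>A\<close> swap \<open>0, 1\<close> over position \<open>0\<close> and
  \<open>A'\<close> swap \<open>1, 2\<close> over position \<open>n\<^sub>k\<close>. The group is generated by the diagonal action of
  \<open>A, A', B\<close> on all \<open>k\<close> at once, where \<open>n\<^sub>k\<close> runs through powers of a power \<open>C\<close> of two and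
  \<open>d\<^sub>k \<ge> 2 n\<^sub>k\<close> is the largest power of two not exceeding \<open>f n\<^sub>k\<close>.

  Lower bound: \<open>n\<^sub>i\<close> and \<open>n\<^sub>k\<close> are incongruent modulo \<open>d\<^sub>k\<close>, so the commutator of \<open>A\<close>
  with \<open>A'\<close> conjugated by \<open>B\<close> to the power \<open>n\<^sub>i\<close> lives in coordinate \<open>i\<close> only. In an action on
  fewer than \<open>2 ^ e\<^sub>i\<close> points all cycles of \<open>B\<close> have length dividing some
  \<open>M = 2 ^ (e\<^sub>i - 1) * odd\<close>; hence \<open>B\<close> to the power \<open>M\<close>, which is a nontrivial rotation of
  coordinate \<open>i\<close>, acts trivially, and so does the short word \<open>[[A, A' conjugated], A]\<close>.

  Upper bound: a word of length \<open>m\<close> cannot distinguish the coordinates with \<open>n\<^sub>k > 2 m + 1\<close>,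
  so a nontrivial one moves a point in the first of these or in an earlier coordinate, and the
  stabilizer of a point of coordinate \<open>k\<close> has index at most \<open>4 d\<^sub>k\<close>.

  By dilation \<open>4 f n \<le> f (C n)\<close>, which absorbs the multiplicative constants.
\<close>

section \<open>Powers and subgroups of finite index\<close>

context group
begin

text \<open>Pigeonhole: two of the cosets \<open>H #> x [^] j\<close>, with \<open>j\<close> from
  \<open>0\<close> to the index, coincide, and the quotient of the two powers lies in
  \<open>H\<close>.\<close>

lemma ex_pow_in_finite_index_subgroup:
  assumes "finite_index_subgroup H G" "x \<in> carrier G"
  shows "\<exists>l. 1 \<le> l \<and> l \<le> card (rcosets H) \<and> x [^] (l::nat) \<in> H"
proof -
  have H: "subgroup H G" and fin: "finite (rcosets H)"
    using assms(1) by (auto simp: finite_index_subgroup_def)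
  let ?k = "card (rcosets H)"
  let ?c = "\<lambda>j::nat. H #> x [^] j"
  have "?c ` {0..?k} \<subseteq> rcosets H"
    using assms(2) by (auto simp: RCOSETS_def)
  then have "card (?c ` {0..?k}) \<le> ?k"
    using fin by (rule card_mono[rotated])
  then have "\<not> inj_on ?c {0..?k}"
    using card_image[of ?c "{0..?k}"] by auto
  then obtain i j where ij: "i < j" "j \<le> ?k" "?c i = ?c j"
    unfolding inj_on_def by (metis atLeastAtMost_iff linorder_neqE_nat)
  have "x [^] j \<in> H #> x [^] i"
    using rcos_self[OF _ H, of "x [^] j"] ij(3) assms(2) by simp
  then obtain h where h: "h \<in> H" "x [^] j = h \<otimes> x [^] i"
    unfolding r_coset_def by blast
  have hc: "h \<in> carrier G"
    by (rule subgroup.mem_carrier[OF H h(1)])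
  have "x [^] j = x [^] (j - i) \<otimes> x [^] i"
    using assms(2) ij(1) by (simp add: nat_pow_mult)
  then have "x [^] (j - i) = h"
    using right_cancel[of "x [^] i" "x [^] (j - i)" h] h(2) hc assms(2) by simp
  then show ?thesis
    using h(1) ij by (intro exI[of _ "j - i"]) auto
qed

lemma conj_pow:
  assumes "g \<in> carrier G" "x \<in> carrier G"
  shows "(g \<otimes> x \<otimes> inv g) [^] (m::nat) = g \<otimes> x [^] m \<otimes> inv g"
proof (induction m)
  case (Suc m)
  have "(g \<otimes> x \<otimes> inv g) [^] Suc m = g \<otimes> x [^] m \<otimes> (inv g \<otimes> g) \<otimes> x \<otimes> inv g"
    unfolding nat_pow_Suc Suc using assms by (simp only: m_assoc m_closed nat_pow_closed inv_closed)
  then show ?case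
    using assms by (simp add: m_assoc)
qed (use assms in simp)

lemma subgroup_pow_closed:
  assumes "subgroup H G" "x \<in> H"
  shows "x [^] (m::nat) \<in> H"
  using assms by (induction m) (auto simp: subgroup.one_closed subgroup.m_closed)

text \<open>\<open>H\<close> need not be normal, so each conjugate of \<open>x\<close> may enter
  \<open>H\<close> at its own exponent \<open>l\<close>; a common multiple \<open>M\<close> of all
  possible exponents serves every conjugate at once.\<close>

lemma conj_pow_in_subgroup:
  assumes "finite_index_subgroup H G" "g \<in> carrier G" "x \<in> carrier G"
    and "\<And>l. 1 \<le> l \<Longrightarrow> l \<le> card (rcosets H) \<Longrightarrow> l dvd M"
  shows "g \<otimes> x [^] (M::nat) \<otimes> inv g \<in> H"
proof -
  let ?y = "g \<otimes> x \<otimes> inv g"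
  have y: "?y \<in> carrier G"
    using assms by simp
  obtain l where l: "1 \<le> l" "l \<le> card (rcosets H)" "?y [^] l \<in> H"
    using ex_pow_in_finite_index_subgroup[OF assms(1) y] by blast
  obtain q where q: "M = l * q"
    using assms(4)[OF l(1,2)] by auto
  have "?y [^] M = (?y [^] l) [^] q"
    using y by (simp add: nat_pow_pow q)
  moreover have "subgroup H G"
    using assms(1) by (simp add: finite_index_subgroup_def)
  ultimately show ?thesis
    using subgroup_pow_closed[OF _ l(3), of q] conj_pow[OF assms(2,3)] by simp
qed

end

text \<open>For \<open>e \<ge> 1\<close>, a common multiple of all positive numbers below
  \<open>2 ^ e\<close> that contains the prime 2 only \<open>e - 1\<close> times, so that a rotation
  of a cycle of length \<open>2 ^ e\<close> by this amount is nontrivial.\<close>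

definition odd_multiple :: "nat \<Rightarrow> nat" where
  "odd_multiple e = 2 ^ (e - 1) * \<Prod>{j. odd j \<and> j < 2 ^ e}"

lemma finite_odd_below: "finite {j::nat. odd j \<and> j < m}"
  by (rule finite_subset[of _ "{..<m}"]) auto

lemma two_power_times_odd:
  assumes "(l::nat) \<ge> 1"
  obtains v j where "l = 2 ^ v * j" "odd j"
  using assms
proof (induction l arbitrary: thesis rule: less_induct)
  case (less l)
  show ?case
  proof (cases "odd l")
    case True
    then show ?thesis
      using less.prems(1)[of 0 l] by simp
  next
    case False
    then obtain q where q: "l = 2 * q" by auto
    then obtain v j where "q = 2 ^ v * j" "odd j"
      using less.IH[of q] less.prems(2) by auto
    then show ?thesis
      using less.prems(1)[of "Suc v" j] q by simp
  qed
qed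

lemma dvd_odd_multiple:
  assumes "1 \<le> l" "l < 2 ^ e"
  shows "l dvd odd_multiple e"
proof -
  obtain v j where j: "l = 2 ^ v * j" "odd j"
    using two_power_times_odd assms(1) by blast
  have j0: "j \<ge> 1"
    using j(2) by (cases j) auto
  have "(2::nat) ^ v \<le> l"
    using j0 j(1) by (metis mult_le_mono2 mult.right_neutral)
  then have "(2::nat) ^ v < 2 ^ e"
    using assms(2) by linarith
  then have v: "v \<le> e - 1"
    by simp
  have "j \<le> l"
    using j(1) by (metis mult_le_mono1 mult_1 one_le_numeral one_le_power)
  then have "j dvd \<Prod>{j. odd j \<and> j < 2 ^ e}"
    using assms(2) j(2) finite_odd_below[of "2 ^ e"] by (intro dvd_prodI[of _ _ "\<lambda>j. j", simplified]) auto
  then show ?thesis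
    using mult_dvd_mono[OF le_imp_power_dvd[OF v, of 2]] by (simp add: odd_multiple_def j(1))
qed

lemma not_dvd_odd_multiple:
  assumes "e \<ge> 1"
  shows "\<not> 2 ^ e dvd odd_multiple e"
proof
  let ?o = "\<Prod>{j::nat. odd j \<and> j < 2 ^ e}"
  assume "2 ^ e dvd odd_multiple e"
  then have "(2::nat) ^ (e - 1) * 2 dvd 2 ^ (e - 1) * ?o"
    using assms by (cases e) (simp_all add: odd_multiple_def mult.commute)
  then have "2 dvd ?o"
    unfolding dvd_times_left_cancel_iff[OF power_not_zero[OF zero_neq_numeral[symmetric]]] .
  then show False
    using even_prod_iff[OF finite_odd_below, of "\<lambda>j. j" "2 ^ e"] by simp
qed


section \<open>Lamp groups on a family of cycles\<close>

text \<open>Coordinate, position and lamp state. All generators fix the states above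
  \<open>2\<close>, so letting the state range over \<open>nat\<close> is harmless.\<close>

type_synonym point = "nat \<times> int \<times> nat"

definition lamp :: "(nat \<Rightarrow> int \<Rightarrow> nat \<Rightarrow> nat) \<Rightarrow> point \<Rightarrow> point" where
  "lamp \<sigma> = (\<lambda>(k, x, j). (k, x, \<sigma> k x j))"

lemma lamp_comp: "lamp \<sigma> \<circ> lamp \<rho> = lamp (\<lambda>k x. \<sigma> k x \<circ> \<rho> k x)"
  by (auto simp: lamp_def fun_eq_iff)

lemma lamp_id: "lamp (\<lambda>k x. id) = id"
  by (auto simp: lamp_def fun_eq_iff)

lemma lamp_comp_eq_id: "(\<And>k x. \<sigma> k x \<circ> \<rho> k x = id) \<Longrightarrow> lamp \<sigma> \<circ> lamp \<rho> = id"
  by (simp add: lamp_comp lamp_id)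

text \<open>The primes differ in meaning: \<open>A'\<close> is the second lamp, while
  \<open>B'\<close> is the inverse of \<open>B\<close>.\<close>

datatype letter = A | A' | B | B'

fun inv_letter :: "letter \<Rightarrow> letter" where
  "inv_letter A = A"
| "inv_letter A' = A'"
| "inv_letter B = B'"
| "inv_letter B' = B"

lemma finite_UNIV_letter: "finite (UNIV :: letter set)"
  by (rule finite_subset[of _ "{A, A', B, B'}"]) (auto intro: letter.exhaust)

text \<open>Positions are integers; the coordinate \<open>k\<close> lives on every block
  \<open>{c * d k ..< (c + 1) * d k}\<close>, and \<open>rot\<close> rotates each block, so no restriction to a
  single fundamental domain is needed.\<close>

locale lamp_family =
  fixes d n :: "nat \<Rightarrow> int"
  assumes d_pos: "0 < d k"
begin

definition rot :: "int \<Rightarrow> point \<Rightarrow> point" where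
  "rot s = (\<lambda>(k, x, j). (k, d k * (x div d k) + (x + s) mod d k, j))"

lemma block_div: "(d k * c + y mod d k) div d k = c"
  using d_pos[of k] by simp

lemma block_mod: "(d k * c + y mod d k) mod d k = y mod d k"
  by (simp add: mod_simps)

lemma rot_comp: "rot s \<circ> rot t = rot (s + t)"
proof -
  have "(d k * c + (x + t) mod d k + s) mod d k = (x + (s + t)) mod d k" for k c x
  proof -
    have "(d k * c + (x + t) mod d k + s) mod d k = (d k * c + (x + t) + s) mod d k"
      by (metis mod_add_left_eq mod_add_right_eq)
    also have "d k * c + (x + t) + s = (x + (s + t)) + d k * c"
      by simp
    also have "\<dots> mod d k = (x + (s + t)) mod d k"
      by (rule mod_mult_self2)
    finally show ?thesis .
  qed
  then show ?thesis
    by (auto simp: rot_def fun_eq_iff block_div)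
qed

lemma rot_0: "rot 0 = id"
  by (auto simp: rot_def fun_eq_iff)

text \<open>Conjugating by a rotation translates the lamp pattern. Periodicity of
  \<open>\<sigma>\<close> accounts for \<open>x - s\<close> leaving the block of
  \<open>x\<close>.\<close>

lemma rot_comp_lamp:
  assumes "\<And>k x y. d k dvd x - y \<Longrightarrow> \<sigma> k x = \<sigma> k y"
  shows "rot s \<circ> lamp \<sigma> \<circ> rot (- s) = lamp (\<lambda>k x. \<sigma> k (x - s))"
proof -
  have "rot s \<circ> lamp \<sigma> \<circ> rot (- s) = lamp (\<lambda>k x. \<sigma> k (x - s)) \<circ> (rot s \<circ> rot (- s))"
  proof (rule ext, clarify)
    fix k x j
    let ?y = "d k * (x div d k) + (x - s) mod d k"
    have "?y mod d k = (x - s) mod d k"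
      by (rule block_mod)
    then have "\<sigma> k ?y = \<sigma> k (x - s)"
      by (intro assms) (simp only: mod_eq_dvd_iff)
    moreover have "rot s (k, ?y, i) = (k, x, i)" for i
      using fun_cong[OF rot_comp[of s "- s"], of "(k, x, i)"] by (simp add: rot_def block_div)
    ultimately show "(rot s \<circ> lamp \<sigma> \<circ> rot (- s)) (k, x, j)
        = (lamp (\<lambda>k x. \<sigma> k (x - s)) \<circ> (rot s \<circ> rot (- s))) (k, x, j)"
      by (simp add: rot_comp rot_0) (simp add: rot_def lamp_def)
  qed
  then show ?thesis
    by (simp add: rot_comp rot_0)
qed

fun gen :: "letter \<Rightarrow> point \<Rightarrow> point" where
  "gen A = lamp (\<lambda>k x. if d k dvd x then transpose 0 1 else id)"
| "gen A' = lamp (\<lambda>k x. if d k dvd x - n k then transpose 1 2 else id)"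
| "gen B = rot 1"
| "gen B' = rot (- 1)"

definition act :: "letter list \<Rightarrow> point \<Rightarrow> point" where
  "act w = foldr (\<circ>) (map gen w) id"

lemma act_Nil [simp]: "act [] = id"
  and act_Cons [simp]: "act (l # w) = gen l \<circ> act w"
  by (simp_all add: act_def)

lemma act_append [simp]: "act (v @ w) = act v \<circ> act w"
  by (induction v) (simp_all add: comp_assoc)

lemma gen_inv_letter: "gen l \<circ> gen (inv_letter l) = id"
  by (cases l) (auto simp: rot_comp rot_0 intro!: lamp_comp_eq_id)

lemma act_inv: "act w \<circ> act (rev (map inv_letter w)) = id"
proof (induction w)
  case (Cons l w)
  have "act (l # w) \<circ> act (rev (map inv_letter (l # w)))
      = gen l \<circ> (act w \<circ> act (rev (map inv_letter w))) \<circ> gen (inv_letter l)"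
    by (simp add: comp_assoc)
  then show ?case
    by (simp only: Cons comp_id gen_inv_letter)
qed simp

lemma act_replicate_B: "act (replicate m B) = rot (int m)"
  by (induction m) (simp_all add: rot_comp rot_0)

lemma act_replicate_B': "act (replicate m B') = rot (- int m)"
  by (induction m) (simp_all add: rot_comp rot_0)


subsection \<open>Short words see only a neighbourhood of the lamps\<close>

text \<open>The action unwrapped to the integer line, with lamps where \<open>p\<close> and
  \<open>q\<close> hold. Without wrap-around, coordinates with different cycle lengths can be
  compared.\<close>

fun run :: "(int \<Rightarrow> bool) \<Rightarrow> (int \<Rightarrow> bool) \<Rightarrow> letter list \<Rightarrow> int \<times> nat \<Rightarrow> int \<times> nat" where
  "run p q [] s = s"
| "run p q (A # w) s = (case run p q w s of (x, j) \<Rightarrow> (x, if p x then transpose 0 1 j else j))"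
| "run p q (A' # w) s = (case run p q w s of (x, j) \<Rightarrow> (x, if q x then transpose 1 2 j else j))"
| "run p q (B # w) s = (case run p q w s of (x, j) \<Rightarrow> (x + 1, j))"
| "run p q (B' # w) s = (case run p q w s of (x, j) \<Rightarrow> (x - 1, j))"

lemma run_near: "\<bar>fst (run p q w (x, j)) - x\<bar> \<le> int (length w)"
proof (induction w)
  case (Cons l w)
  then show ?case
    by (cases l) (auto split: prod.split)
qed simp

text \<open>By \<open>run_near\<close> the walk stays within \<open>length w\<close> of its start,
  so only lamps inside that window are ever consulted.\<close>

lemma run_local:
  assumes "\<And>u. \<bar>u\<bar> \<le> int (length w) \<Longrightarrow> p (x + u) = p' (y + u) \<and> q (x + u) = q' (y + u)"
  shows "fst (run p q w (x, j)) - x = fst (run p' q' w (y, j)) - y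
    \<and> snd (run p q w (x, j)) = snd (run p' q' w (y, j))"
  using assms
proof (induction w)
  case (Cons l w)
  obtain X i where X: "run p q w (x, j) = (X, i)" by fastforce
  obtain Y i' where Y: "run p' q' w (y, j) = (Y, i')" by fastforce
  have IH: "X - x = Y - y" "i = i'"
    using Cons X Y by auto
  have "\<bar>X - x\<bar> \<le> int (length w)"
    using run_near[of p q w x j] X by simp
  then have "p X = p' Y \<and> q X = q' Y"
    using Cons.prems[of "X - x"] arg_cong[OF IH(1), of "\<lambda>t. y + t"] by simp
  then show ?case
    using IH by (cases l) (auto simp: X Y)
qed simp

abbreviation run_in :: "nat \<Rightarrow> letter list \<Rightarrow> int \<times> nat \<Rightarrow> int \<times> nat" where
  "run_in k \<equiv> run (\<lambda>x. d k dvd x) (\<lambda>x. d k dvd x - n k)"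

text \<open>Lamp tests and unit steps depend on the position modulo \<open>d k\<close> only, so
  reduction can wait until the end of the walk.\<close>

lemma act_eq_run:
  "act w (k, x, j) =
    (k, d k * (x div d k) + fst (run_in k w (x, j)) mod d k, snd (run_in k w (x, j)))"
proof (induction w)
  case (Cons l w)
  obtain X i where X: "run_in k w (x, j) = (X, i)" by fastforce
  let ?Y = "d k * (x div d k) + X mod d k"
  have dvd: "d k dvd ?Y - t \<longleftrightarrow> d k dvd X - t" for t
    by (metis block_mod mod_eq_dvd_iff)
  have shift: "(?Y + t) mod d k = (X + t) mod d k" for t
    by (metis block_mod mod_add_left_eq)
  show ?case
    using dvd[of 0] dvd[of "n k"] shift[of 1] shift[of "- 1"]
    by (cases l) (auto simp: Cons X lamp_def rot_def block_div)
qed simp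

lemma dvd_imp_eq_0: "d k dvd x \<Longrightarrow> \<bar>x\<bar> < d k \<Longrightarrow> x = 0"
  using dvd_imp_le_int[of x "d k"] d_pos[of k] by linarith

text \<open>On both cycles the lamps are farther apart than the width of the window about a point,
  so the window about \<open>x\<close> contains at most one lamp, and some \<open>y\<close> in
  coordinate \<open>l\<close> has the same window.\<close>

lemma act_nontrivial_transfer:
  assumes move: "act w (k, x, j) \<noteq> (k, x, j)"
    and k: "2 * int (length w) + 1 < n k" "2 * n k \<le> d k"
    and l: "2 * int (length w) + 1 < n l" "2 * n l \<le> d l"
  shows "\<exists>y. act w (l, y, j) \<noteq> (l, y, j)"
proof -
  let ?m = "int (length w)"
  have small: "\<bar>v\<bar> < d k" "\<bar>v\<bar> < d l" if "\<bar>v\<bar> \<le> 2 * ?m" for v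
    using that k l by linarith+
  obtain y where y: "\<And>u. \<bar>u\<bar> \<le> ?m \<Longrightarrow>
      (d k dvd x + u) = (d l dvd y + u) \<and> (d k dvd x + u - n k) = (d l dvd y + u - n l)"
  proof -
    \<comment> \<open>If a lamp is visible at offset \<open>v\<close>, then \<open>y\<close> is
      chosen to see the same kind of lamp at offset \<open>v\<close>.\<close>
    consider v where "\<bar>v\<bar> \<le> ?m" "d k dvd x + v" | v where "\<bar>v\<bar> \<le> ?m" "d k dvd x + v - n k"
      | "\<And>u. \<bar>u\<bar> \<le> ?m \<Longrightarrow> \<not> d k dvd x + u \<and> \<not> d k dvd x + u - n k"
      by blast
    then show ?thesis
    proof cases
      case 1
      show ?thesis
      proof (rule that[of "- v"])
        fix u :: int assume u: "\<bar>u\<bar> \<le> ?m"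
        have a: "d k dvd x + u - t \<longleftrightarrow> d k dvd u - v - t" for t
          using dvd_add_right_iff[OF 1(2), of "u - v - t"] by (simp add: algebra_simps)
        have b: "d k dvd u - v \<longleftrightarrow> d l dvd u - v"
        proof -
          have "\<bar>u - v\<bar> \<le> 2 * ?m"
            using u 1(1) by linarith
          then show ?thesis
            using dvd_imp_eq_0[of k "u - v"] dvd_imp_eq_0[of l "u - v"] small[of "u - v"]
            by (metis dvd_0_right)
        qed
        have c: "\<not> d k dvd u - v - n k" "\<not> d l dvd u - v - n l"
          using dvd_imp_eq_0[of k "u - v - n k"] dvd_imp_eq_0[of l "u - v - n l"] u 1(1) k l
          by linarith+
        show "(d k dvd x + u) = (d l dvd - v + u) \<and> (d k dvd x + u - n k) = (d l dvd - v + u - n l)"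
          using a[of 0] a[of "n k"] b c by (simp add: algebra_simps)
      qed
    next
      case 2
      show ?thesis
      proof (rule that[of "n l - v"])
        fix u :: int assume u: "\<bar>u\<bar> \<le> ?m"
        have a: "d k dvd x + u - t \<longleftrightarrow> d k dvd u - v + n k - t" for t
          using dvd_add_right_iff[OF 2(2), of "u - v + n k - t"] by (simp add: algebra_simps)
        have b: "d k dvd u - v \<longleftrightarrow> d l dvd u - v"
        proof -
          have "\<bar>u - v\<bar> \<le> 2 * ?m"
            using u 2(1) by linarith
          then show ?thesis
            using dvd_imp_eq_0[of k "u - v"] dvd_imp_eq_0[of l "u - v"] small[of "u - v"]
            by (metis dvd_0_right)
        qed
        have c: "\<not> d k dvd u - v + n k" "\<not> d l dvd u - v + n l"
          using dvd_imp_eq_0[of k "u - v + n k"] dvd_imp_eq_0[of l "u - v + n l"] u 2(1) k l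
          by linarith+
        show "(d k dvd x + u) = (d l dvd n l - v + u)
            \<and> (d k dvd x + u - n k) = (d l dvd n l - v + u - n l)"
          using a[of 0] a[of "n k"] b c by (simp add: algebra_simps)
      qed
    next
      case 3
      \<comment> \<open>The window about \<open>?m + 1\<close> runs from \<open>1\<close> to
        \<open>2 * ?m + 1\<close>, strictly between the lamps at \<open>0\<close> and
        \<open>n l\<close>.\<close>
      show ?thesis
      proof (rule that[of "?m + 1"])
        fix u :: int assume u: "\<bar>u\<bar> \<le> ?m"
        have "\<not> d l dvd ?m + 1 + u"
          using dvd_imp_eq_0[of l "?m + 1 + u"] u l by linarith
        moreover have "\<not> d l dvd ?m + 1 + u - n l"
          using dvd_imp_eq_0[of l "?m + 1 + u - n l"] u l by linarith
        ultimately show "(d k dvd x + u) = (d l dvd ?m + 1 + u)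
            \<and> (d k dvd x + u - n k) = (d l dvd ?m + 1 + u - n l)"
          using 3[OF u] by simp
      qed
    qed
  qed
  let ?X = "run_in k w (x, j)" and ?Y = "run_in l w (y, j)"
  have "fst ?X - x = fst ?Y - y \<and> snd ?X = snd ?Y"
    by (rule run_local) (rule y)
  then have eq: "fst ?X - x = fst ?Y - y" "snd ?X = snd ?Y"
    by simp_all
  \<comment> \<open>A fixed point forces the displacement on the line to be a multiple of
    \<open>d l\<close> shorter than \<open>d l\<close>, hence zero; the equal displacement from
    \<open>x\<close> is then zero too.\<close>
  have "act w (l, y, j) \<noteq> (l, y, j)"
  proof
    assume fix_y: "act w (l, y, j) = (l, y, j)"
    then have "d l * (y div d l) + fst ?Y mod d l = y" "snd ?Y = j"
      by (auto simp: act_eq_run)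
    then have "fst ?Y mod d l = y mod d l"
      using block_mod[of l "y div d l" "fst ?Y"] by simp
    then have "d l dvd fst ?Y - y"
      by (simp add: mod_eq_dvd_iff)
    moreover have "\<bar>fst ?Y - y\<bar> \<le> ?m"
      by (rule run_near)
    then have "\<bar>fst ?Y - y\<bar> < d l"
      by (intro small(2)) linarith
    ultimately have "fst ?Y - y = 0"
      by (rule dvd_imp_eq_0)
    then have "fst ?X = x" "snd ?X = j"
      using eq \<open>snd ?Y = j\<close> by auto
    then show False
      using move by (simp add: act_eq_run)
  qed
  then show "\<exists>y. act w (l, y, j) \<noteq> (l, y, j)" by blast
qed

lemma snd_run: "snd (run p q w (x, j)) \<in> {0, 1, 2, j}"
proof (induction w)
  case (Cons l w)
  then show ?case
    by (cases l) (auto split: prod.splits simp: transpose_def)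
qed simp

text \<open>A superset of the orbit that is easy to count; \<open>j\<close> is listed because it may
  exceed \<open>2\<close>, whence the factor 4 in \<open>card_orbit_bound\<close>.\<close>

definition orbit_bound :: "point \<Rightarrow> point set" where
  "orbit_bound = (\<lambda>(k, x, j).
    {k} \<times> (\<lambda>y. d k * (x div d k) + y) ` {0..<d k} \<times> {0, 1, 2, j})"

lemma act_in_orbit_bound: "act w z \<in> orbit_bound z"
  using d_pos snd_run by (cases z) (auto simp: orbit_bound_def act_eq_run)

lemma finite_orbit_bound: "finite (orbit_bound z)"
  by (cases z) (auto simp: orbit_bound_def)

lemma card_orbit_bound: "card (orbit_bound (k, x, j)) \<le> 4 * nat (d k)"
proof -
  have "card {0, 1, 2, j} \<le> 4"
    using card_length[of "[0, 1, 2, j]"] by simp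
  moreover have "card ((\<lambda>y. d k * (x div d k) + y) ` {0..<d k}) \<le> nat (d k)"
    using card_image_le[of "{0..<d k}"] by simp
  ultimately have "card ((\<lambda>y. d k * (x div d k) + y) ` {0..<d k}) * card {0, 1, 2, j} \<le> nat (d k) * 4"
    by (intro mult_le_mono)
  moreover have "card (orbit_bound (k, x, j)) =
      card ((\<lambda>y. d k * (x div d k) + y) ` {0..<d k}) * card {0, 1, 2, j}"
    unfolding orbit_bound_def prod.case card_cartesian_product by simp
  ultimately show ?thesis
    by linarith
qed

end


section \<open>Commutators supported in one coordinate\<close>

abbreviation "swap01 \<equiv> transpose (0::nat) 1"
abbreviation "swap12 \<equiv> transpose (1::nat) 2"

text \<open>The commutator of the two swaps, a 3-cycle.\<close>

definition cyc :: "nat \<Rightarrow> nat" where "cyc = swap01 \<circ> swap12 \<circ> swap01 \<circ> swap12"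
definition cyc' :: "nat \<Rightarrow> nat" where "cyc' = swap12 \<circ> swap01 \<circ> swap12 \<circ> swap01"

lemma cyc'_comp_cyc: "cyc' \<circ> cyc = id" and cyc_comp_cyc': "cyc \<circ> cyc' = id"
  by (simp_all add: cyc_def cyc'_def fun_eq_iff)

lemma swap_commutators_nontrivial: "cyc \<circ> swap01 \<circ> cyc' \<circ> swap01 \<noteq> id"
proof
  assume "cyc \<circ> swap01 \<circ> cyc' \<circ> swap01 = id"
  then have "(cyc \<circ> swap01 \<circ> cyc' \<circ> swap01) 0 = 0" by simp
  then show False by (simp add: cyc_def cyc'_def transpose_def)
qed

definition lamp_at :: "(nat \<Rightarrow> int \<Rightarrow> bool) \<Rightarrow> (nat \<Rightarrow> nat) \<Rightarrow> point \<Rightarrow> point" where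
  "lamp_at P \<rho> = lamp (\<lambda>k x. if P k x then \<rho> else id)"

locale separated_lamp_family = lamp_family +
  assumes n_nonneg: "0 \<le> n k"
    and separated: "i \<noteq> k \<Longrightarrow> \<not> d k dvd n i - n k"
begin

lemma rot_comp_lamp_at:
  assumes "\<And>k x y. d k dvd x - y \<Longrightarrow> P k x = P k y"
  shows "rot s \<circ> lamp_at P \<rho> \<circ> rot (- s) = lamp_at (\<lambda>k x. P k (x - s)) \<rho>"
  unfolding lamp_at_def using assms by (intro rot_comp_lamp) simp

lemma dvd_periodic: "d k dvd x - y \<Longrightarrow> d k dvd x - t \<longleftrightarrow> d k dvd y - t"
  using dvd_add_right_iff[of "d k" "x - y" "y - t"] by simp

lemma dvd_periodic_0: "d k dvd x - y \<Longrightarrow> d k dvd x \<longleftrightarrow> d k dvd y"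
  using dvd_periodic[of k x y 0] by simp

text \<open>\<open>A'\<close> conjugated by a rotation: its lamp in coordinate \<open>k\<close>
  moves from \<open>n k\<close> to \<open>n k - n i\<close>, which by \<open>separated\<close> is
  the origin only for \<open>k = i\<close>.\<close>

definition site_word :: "nat \<Rightarrow> letter list" where
  "site_word i = replicate (nat (n i)) B' @ [A'] @ replicate (nat (n i)) B"

lemma act_site_word: "act (site_word i) = lamp_at (\<lambda>k x. d k dvd x - (n k - n i)) swap12"
proof -
  have "act (site_word i) = rot (- n i) \<circ> lamp_at (\<lambda>k x. d k dvd x - n k) swap12 \<circ> rot (- (- n i))"
    by (simp add: site_word_def act_replicate_B act_replicate_B' n_nonneg lamp_at_def comp_assoc
        del: One_nat_def)
  then show ?thesis
    by (subst (asm) rot_comp_lamp_at) (auto simp: algebra_simps dest: dvd_periodic)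
qed

text \<open>The commutator of \<open>A\<close> with \<open>site_word i\<close>; both are
  involutions, so no inverses appear.\<close>

definition cyc_word :: "nat \<Rightarrow> letter list" where
  "cyc_word i = [A] @ site_word i @ [A] @ site_word i"

definition cyc_word' :: "nat \<Rightarrow> letter list" where
  "cyc_word' i = site_word i @ [A] @ site_word i @ [A]"

text \<open>The second commutator is again with \<open>A\<close>, which does nothing where a
  rotation nonzero modulo \<open>d i\<close> puts the lamp of \<open>cyc_word i\<close>.\<close>

definition probe_word :: "nat \<Rightarrow> letter list" where
  "probe_word i = cyc_word i @ [A] @ cyc_word' i @ [A]"

lemma length_probe_word: "length (probe_word i) = 8 * nat (n i) + 10"
  by (simp add: probe_word_def cyc_word_def cyc_word'_def site_word_def)

abbreviation at_origin :: "nat \<Rightarrow> nat \<Rightarrow> int \<Rightarrow> bool" where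
  "at_origin i k x \<equiv> k = i \<and> d k dvd x"

lemma site_at_origin:
  "d k dvd x \<Longrightarrow> d k dvd x - (n k - n i) \<longleftrightarrow> k = i"
  using separated[of i k] dvd_add_right_iff[of "d k" x "n i - n k"] by (auto simp: algebra_simps)

lemma act_A: "act [A] = lamp_at (\<lambda>k x. d k dvd x) swap01"
  by (simp add: lamp_at_def del: One_nat_def)

text \<open>Where just one of the two involutions acts, it acts twice and cancels; by
  \<open>site_at_origin\<close> both act only at the origin of coordinate \<open>i\<close>.\<close>

lemma act_cyc_word: "act (cyc_word i) = lamp_at (at_origin i) cyc"
proof -
  have "act (cyc_word i) = act [A] \<circ> act (site_word i) \<circ> act [A] \<circ> act (site_word i)"
    by (simp add: cyc_word_def comp_assoc)
  also have "\<dots> = lamp_at (at_origin i) cyc"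
    unfolding act_A act_site_word lamp_at_def lamp_comp
    by (rule arg_cong[of _ _ lamp]) (use site_at_origin[of _ _ i] in \<open>force simp: cyc_def fun_eq_iff\<close>)
  finally show ?thesis .
qed

lemma act_cyc_word': "act (cyc_word' i) = lamp_at (at_origin i) cyc'"
proof -
  have "act (cyc_word' i) = act (site_word i) \<circ> act [A] \<circ> act (site_word i) \<circ> act [A]"
    by (simp add: cyc_word'_def comp_assoc)
  also have "\<dots> = lamp_at (at_origin i) cyc'"
    unfolding act_A act_site_word lamp_at_def lamp_comp
    by (rule arg_cong[of _ _ lamp]) (use site_at_origin[of _ _ i] in \<open>force simp: cyc'_def fun_eq_iff\<close>)
  finally show ?thesis .
qed

lemma act_probe_word:
  "act (probe_word i) = lamp_at (at_origin i) (cyc \<circ> swap01 \<circ> cyc' \<circ> swap01)"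
proof -
  have "act (probe_word i) = act (cyc_word i) \<circ> act [A] \<circ> act (cyc_word' i) \<circ> act [A]"
    by (simp add: probe_word_def comp_assoc)
  also have "\<dots> = lamp_at (at_origin i) (cyc \<circ> swap01 \<circ> cyc' \<circ> swap01)"
    unfolding act_A act_cyc_word act_cyc_word' lamp_at_def lamp_comp
    by (rule arg_cong[of _ _ lamp]) (auto simp: fun_eq_iff)
  finally show ?thesis .
qed

lemma probe_word_nontrivial: "act (probe_word i) \<noteq> id"
proof
  assume id: "act (probe_word i) = id"
  have "(cyc \<circ> swap01 \<circ> cyc' \<circ> swap01) j = j" for j
    using fun_cong[OF id, of "(i, 0, j)"] by (simp add: act_probe_word lamp_at_def lamp_def)
  then show False
    using swap_commutators_nontrivial by (simp add: fun_eq_iff)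
qed

text \<open>A rotation \<open>rot m\<close> by an amount nonzero modulo \<open>d i\<close> moves the lamp of \<open>cyc_word i\<close> away from the origin,
  so \<open>probe_word i\<close> is a product of conjugates of \<open>rot m\<close> and its inverse.\<close>

lemma probe_word_from_rot:
  assumes "\<not> d i dvd m"
  defines "Y \<equiv> act (cyc_word i)" and "Y' \<equiv> act (cyc_word' i)" and "a \<equiv> act [A]"
  shows "(Y \<circ> rot m \<circ> Y') \<circ> rot (- m) \<circ> (a \<circ> rot m \<circ> a) \<circ> (a \<circ> Y \<circ> rot (- m) \<circ> (Y' \<circ> a))
    = act (probe_word i)" (is "?lhs = _")
proof -
  have aa: "a (a z) = z" for z
    using fun_cong[OF gen_inv_letter[of A], of z] by (simp add: a_def)
  have Y': "rot m \<circ> Y' \<circ> rot (- m) = lamp_at (\<lambda>k x. at_origin i k (x - m)) cyc'"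
    unfolding Y'_def act_cyc_word' by (rule rot_comp_lamp_at) (metis dvd_periodic_0)
  have Y: "rot m \<circ> Y \<circ> rot (- m) = lamp_at (\<lambda>k x. at_origin i k (x - m)) cyc"
    unfolding Y_def act_cyc_word by (rule rot_comp_lamp_at) (metis dvd_periodic_0)
  \<comment> \<open>Cancelling \<open>a \<circ> a\<close> leaves the commutator with
    \<open>a\<close> of the commutator of \<open>Y\<close> with \<open>rot m\<close>.\<close>
  have "?lhs = Y \<circ> (rot m \<circ> Y' \<circ> rot (- m)) \<circ> a \<circ> (rot m \<circ> Y \<circ> rot (- m)) \<circ> Y' \<circ> a"
    by (simp add: fun_eq_iff aa)
  also have "\<dots> = act (probe_word i)"
    unfolding Y Y'
    unfolding Y_def Y'_def a_def act_A act_cyc_word act_cyc_word' act_probe_word lamp_at_def lamp_comp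
  proof (intro arg_cong[of _ _ lamp] ext)
    fix k x j
    \<comment> \<open>The displaced lamp never meets \<open>a\<close> in coordinate
      \<open>i\<close>, so its factors \<open>cyc'\<close> and \<open>cyc\<close> cancel.\<close>
    have "\<not> (d i dvd x \<and> d i dvd x - m)"
      using assms(1) dvd_diff[of "d i" x "x - m"] by auto
    then show "((if at_origin i k x then cyc else id) \<circ> (if at_origin i k (x - m) then cyc' else id)
        \<circ> (if d k dvd x then swap01 else id) \<circ> (if at_origin i k (x - m) then cyc else id)
        \<circ> (if at_origin i k x then cyc' else id) \<circ> (if d k dvd x then swap01 else id)) j
      = (if at_origin i k x then cyc \<circ> swap01 \<circ> cyc' \<circ> swap01 else id) j"
      using fun_cong[OF cyc'_comp_cyc] by auto
  qed
  finally show ?thesis .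
qed

end


section \<open>Groups represented by words\<close>

text \<open>\<open>G\<close> is a copy on the natural numbers of the permutation group
  \<open>range act\<close>, and \<open>\<phi>\<close> is the isomorphism.\<close>

locale lamp_group = separated_lamp_family d n + group G
  for d n :: "nat \<Rightarrow> int" and G :: "nat monoid" (structure) +
  fixes \<phi> :: "nat \<Rightarrow> point \<Rightarrow> point"
  assumes inj_phi: "inj_on \<phi> (carrier G)"
    and phi_mult: "x \<in> carrier G \<Longrightarrow> y \<in> carrier G \<Longrightarrow> \<phi> (x \<otimes> y) = \<phi> x \<circ> \<phi> y"
    and phi_image: "\<phi> ` carrier G = range act"
begin

lemma obtain_act: obtains g where "g \<in> carrier G" "\<phi> g = act w"
  using phi_image by (metis image_iff rangeI)

lemma phi_one: "\<phi> \<one> = id"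
proof -
  obtain e where e: "e \<in> carrier G" "\<phi> e = id"
    using obtain_act[of "[]"] by auto
  then have "\<phi> (e \<otimes> e) = \<phi> e"
    by (simp add: phi_mult)
  then have "e \<otimes> e = e"
    using inj_phi e(1) by (simp add: inj_on_eq_iff)
  then have "e = \<one>"
    using e(1) by (simp add: l_cancel_one)
  then show ?thesis
    using e(2) by simp
qed

lemma phi_eq_id_iff: "g \<in> carrier G \<Longrightarrow> \<phi> g = id \<longleftrightarrow> g = \<one>"
  using inj_phi phi_one by (metis inj_onD one_closed)

lemma phi_inv_comp: "g \<in> carrier G \<Longrightarrow> \<phi> (inv g) \<circ> \<phi> g = id"
  by (simp add: phi_mult[symmetric] phi_one)

lemma phi_comp_inv: "g \<in> carrier G \<Longrightarrow> \<phi> g \<circ> \<phi> (inv g) = id"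
  by (simp add: phi_mult[symmetric] phi_one)

lemma phi_inv:
  assumes "g \<in> carrier G" "\<phi> g \<circ> F = id"
  shows "\<phi> (inv g) = F"
proof -
  have "\<phi> (inv g) = \<phi> (inv g) \<circ> (\<phi> g \<circ> F)"
    by (simp add: assms(2))
  also have "\<dots> = F"
    by (simp only: comp_assoc[symmetric] phi_inv_comp[OF assms(1)] id_comp)
  finally show ?thesis .
qed

lemma phi_pow_rot:
  assumes "g \<in> carrier G" "\<phi> g = rot 1"
  shows "\<phi> (g [^] (m::nat)) = rot (int m)"
  by (induction m) (use assms in \<open>simp_all add: phi_one phi_mult rot_0 rot_comp algebra_simps\<close>)


subsection \<open>The lower bound\<close>

text \<open>Every positive number up to the index divides \<open>M\<close>, so all conjugates of
  \<open>x [^] M\<close> lie in \<open>H\<close>; \<open>probe_word_from_rot\<close> builds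
  \<open>w\<close> from them and their inverses.\<close>

lemma probe_in_small_index_subgroup:
  assumes "d i = 2 ^ e" "1 \<le> e"
    and H: "finite_index_subgroup H G" "card (rcosets H) < 2 ^ e"
    and w: "w \<in> carrier G" "\<phi> w = act (probe_word i)"
  shows "w \<in> H"
proof -
  define M where "M = odd_multiple e"
  have M: "\<not> d i dvd int M"
    using not_dvd_odd_multiple[OF assms(2)] int_dvd_int_iff[of "2 ^ e" M]
    by (simp add: M_def assms(1))
  obtain a where a: "a \<in> carrier G" "\<phi> a = act [A]" by (rule obtain_act)
  obtain x where x: "x \<in> carrier G" "\<phi> x = act [B]" by (rule obtain_act)
  obtain y where y: "y \<in> carrier G" "\<phi> y = act (cyc_word i)" by (rule obtain_act)
  have conj: "g \<otimes> x [^] M \<otimes> inv g \<in> H" if "g \<in> carrier G" for g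
    unfolding M_def using H(2) that x(1)
    by (intro conj_pow_in_subgroup[OF H(1)] dvd_odd_multiple) auto
  define p where "p = x [^] M"
  have p: "p \<in> carrier G" "\<phi> p = rot (int M)"
    using x by (auto simp: p_def phi_pow_rot)
  have sub: "subgroup H G"
    using H(1) by (simp add: finite_index_subgroup_def)
  have "p \<in> H"
    using conj[of \<one>] p(1) by (simp add: p_def)
  have inv_a: "\<phi> (inv a) = act [A]"
    using gen_inv_letter[of A] by (intro phi_inv[OF a(1)]) (simp add: a(2))
  have inv_y: "\<phi> (inv y) = act (cyc_word' i)"
    by (intro phi_inv[OF y(1)])
      (auto simp: y(2) act_cyc_word act_cyc_word' lamp_at_def cyc_comp_cyc' intro!: lamp_comp_eq_id)
  have inv_p: "\<phi> (inv p) = rot (- int M)"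
    by (intro phi_inv[OF p(1)]) (simp add: p(2) rot_comp rot_0)
  define q where "q = (a \<otimes> y) \<otimes> inv p \<otimes> inv (a \<otimes> y)"
  have "q = inv ((a \<otimes> y) \<otimes> p \<otimes> inv (a \<otimes> y))"
    using a(1) y(1) p(1) by (simp add: q_def inv_mult_group m_assoc)
  then have "q \<in> H"
    using conj[of "a \<otimes> y"] a(1) y(1) subgroup.m_inv_closed[OF sub] by (simp add: p_def)
  \<comment> \<open>The four factors are those of \<open>probe_word_from_rot\<close>, in the same
    order.\<close>
  define t where "t = (y \<otimes> p \<otimes> inv y) \<otimes> inv p \<otimes> (a \<otimes> p \<otimes> inv a) \<otimes> q"
  have "t \<in> H"
    unfolding t_def p_def using \<open>p \<in> H\<close> \<open>q \<in> H\<close> unfolding p_def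
    by (rule subgroup.m_closed[OF sub subgroup.m_closed[OF sub subgroup.m_closed[OF sub
      conj[OF y(1)] subgroup.m_inv_closed[OF sub]] conj[OF a(1)]]])
  have "\<phi> q = act [A] \<circ> act (cyc_word i) \<circ> rot (- int M) \<circ> (act (cyc_word' i) \<circ> act [A])"
    using a y p(1) by (simp only: q_def phi_mult inv_mult_group inv_closed m_closed inv_a inv_y inv_p)
  moreover have q: "q \<in> carrier G"
    by (rule subgroup.mem_carrier[OF sub \<open>q \<in> H\<close>])
  ultimately have "\<phi> t = act (probe_word i)"
    unfolding t_def probe_word_from_rot[OF M, symmetric] using a y p
    by (simp only: phi_mult inv_closed m_closed inv_a inv_y inv_p)
  then have "\<phi> t = \<phi> w"
    by (simp only: w(2))
  then have "t = w"
    by (rule inj_onD[OF inj_phi _ subgroup.mem_carrier[OF sub \<open>t \<in> H\<close>] w(1)])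
  then show ?thesis
    using \<open>t \<in> H\<close> by simp
qed

subsection \<open>The upper bound\<close>

text \<open>Orbit-stabilizer: the right coset of \<open>h\<close> consists of the elements taking
  \<open>\<phi> (inv h) z\<close> to \<open>z\<close>, so cosets are indexed by points of the
  orbit.\<close>

lemma stabilizer:
  assumes "g \<in> carrier G" "\<phi> g z \<noteq> z"
  obtains H where "finite_index_subgroup H G" "g \<notin> H"
    "card (rcosets H) \<le> card (orbit_bound z)"
proof -
  let ?H = "{h \<in> carrier G. \<phi> h z = z}"
  let ?T = "\<lambda>v. {h \<in> carrier G. \<phi> h v = z}"
  have inv_app: "\<phi> (inv h) (\<phi> h u) = u" "\<phi> h (\<phi> (inv h) u) = u" if "h \<in> carrier G" for h u
    using fun_cong[OF phi_inv_comp[OF that], of u] fun_cong[OF phi_comp_inv[OF that], of u] by simp_all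
  have sub: "subgroup ?H G"
  proof (rule subgroupI)
    show "inv h \<in> ?H" if "h \<in> ?H" for h
      using that inv_app(1)[of h z] by simp
  qed (auto simp: phi_mult phi_one intro!: exI[of _ \<one>])
  have coset: "?H #> h = ?T (\<phi> (inv h) z)" if h: "h \<in> carrier G" for h
  proof
    show "?H #> h \<subseteq> ?T (\<phi> (inv h) z)"
      using h by (auto simp: r_coset_def phi_mult inv_app)
    show "?T (\<phi> (inv h) z) \<subseteq> ?H #> h"
    proof
      fix u assume u: "u \<in> ?T (\<phi> (inv h) z)"
      then have "u \<otimes> inv h \<in> ?H" "u = u \<otimes> inv h \<otimes> h"
        using h by (auto simp: phi_mult m_assoc)
      then show "u \<in> ?H #> h"
        unfolding r_coset_def by blast
    qed
  qed
  have "\<phi> (inv h) z \<in> orbit_bound z" if "h \<in> carrier G" for h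
  proof -
    have "\<phi> (inv h) \<in> range act"
      using phi_image that by blast
    then show ?thesis
      using act_in_orbit_bound by (metis imageE)
  qed
  then have ran: "rcosets ?H \<subseteq> ?T ` orbit_bound z"
    using coset by (auto simp: RCOSETS_def)
  have "card (rcosets ?H) \<le> card (orbit_bound z)"
    by (rule surj_card_le[OF finite_orbit_bound ran])
  moreover have "finite_index_subgroup ?H G"
    using sub finite_subset[OF ran] finite_orbit_bound by (simp add: finite_index_subgroup_def)
  moreover have "g \<notin> ?H"
    using assms by simp
  ultimately show thesis
    by (rule that[rotated 2])
qed

lemma residually_finite: "residually_finite G"
  unfolding residually_finite_def
proof
  fix g assume g: "g \<in> carrier G - {\<one>}"
  then obtain z where "\<phi> g z \<noteq> z"
    using phi_eq_id_iff[of g] by (auto simp: fun_eq_iff)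
  then show "\<exists>H. finite_index_subgroup H G \<and> g \<notin> H"
    using stabilizer[of g z] g by blast
qed

lemma depth_le:
  assumes "g \<in> carrier G" "\<phi> g (k, x, j) \<noteq> (k, x, j)"
  shows "depth G g \<le> 4 * nat (d k)"
proof -
  obtain H where "finite_index_subgroup H G" "g \<notin> H"
      "card (rcosets H) \<le> card (orbit_bound (k, x, j))"
    using stabilizer[OF assms] .
  then have "depth G g \<le> card (orbit_bound (k, x, j))"
    unfolding depth_def by (intro order.trans[OF Least_le]) auto
  then show ?thesis
    using card_orbit_bound[of k x j] by linarith
qed

text \<open>By residual finiteness the \<open>LEAST\<close> in \<open>depth\<close> is attained by a
  subgroup missing \<open>w\<close>, whose index cannot be below \<open>2 ^ e\<close>.\<close>

lemma depth_probe_ge: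
  assumes "d i = 2 ^ e" "1 \<le> e" "w \<in> carrier G" "\<phi> w = act (probe_word i)"
  shows "2 ^ e \<le> depth G w"
proof -
  have "w \<noteq> \<one>"
    using assms(4) probe_word_nontrivial[of i] phi_one by auto
  then have "\<exists>k H. finite_index_subgroup H G \<and> w \<notin> H \<and> k = card (rcosets H)"
    using residually_finite assms(3) by (auto simp: residually_finite_def)
  then have "\<exists>H. finite_index_subgroup H G \<and> w \<notin> H \<and> depth G w = card (rcosets H)"
    unfolding depth_def by (rule LeastI_ex)
  then show ?thesis
    using probe_in_small_index_subgroup[OF assms(1,2) _ _ assms(3,4)] by (metis not_le)
qed

text \<open>If the moved point lies in a coordinate beyond \<open>l\<close>, the word is too short
  to tell that coordinate from \<open>l\<close>, and also moves a point of \<open>l\<close>.\<close>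

lemma depth_le_of_short:
  assumes g: "g \<in> carrier G" "g \<noteq> \<one>" "\<phi> g = act w"
    and l: "2 * int (length w) + 1 < n l"
    and mono: "\<And>k. 2 * n k \<le> d k" "\<And>k. k \<le> l \<Longrightarrow> d k \<le> d l" "mono n"
  shows "depth G g \<le> 4 * nat (d l)"
proof -
  obtain k x j where z: "\<phi> g (k, x, j) \<noteq> (k, x, j)"
    using phi_eq_id_iff[OF g(1)] g(2) by (auto simp: fun_eq_iff)
  show ?thesis
  proof (cases "k \<le> l")
    case True
    then show ?thesis
      using depth_le[OF g(1) z] mono(2)[of k] nat_mono[of "d k" "d l"] by linarith
  next
    case False
    then have "2 * int (length w) + 1 < n k"
      using l monoD[OF mono(3), of l k] by linarith
    then obtain y where "\<phi> g (l, y, j) \<noteq> (l, y, j)"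
      using act_nontrivial_transfer[of w k x j l] z l mono(1) g(3) by auto
    then show ?thesis
      by (rule depth_le[OF g(1)])
  qed
qed


subsection \<open>Word balls\<close>

text \<open>Length is counted in letters. A ball will itself serve as generating set, which rescales
  all lengths by the constant \<open>r\<close>.\<close>

definition ball :: "nat \<Rightarrow> nat set" where
  "ball r = {g \<in> carrier G. \<exists>w. length w \<le> r \<and> \<phi> g = act w}"

lemma finite_ball: "finite (ball r)"
proof -
  have "\<phi> ` ball r \<subseteq> act ` {w. set w \<subseteq> UNIV \<and> length w \<le> r}"
    by (auto simp: ball_def)
  then have "finite (\<phi> ` ball r)"
    using finite_lists_length_le[OF finite_UNIV_letter, of r] by (meson finite_imageI finite_subset)
  then show ?thesis
    by (rule finite_imageD) (rule inj_on_subset[OF inj_phi], auto simp: ball_def)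
qed

lemma inv_ball: "g \<in> ball r \<Longrightarrow> inv g \<in> ball r"
proof -
  assume "g \<in> ball r"
  then obtain w where w: "g \<in> carrier G" "length w \<le> r" "\<phi> g = act w"
    by (auto simp: ball_def)
  then have "\<phi> (inv g) = act (rev (map inv_letter w))"
    by (intro phi_inv) (simp_all add: act_inv)
  then show ?thesis
    using w unfolding ball_def by (intro CollectI conjI exI[of _ "rev (map inv_letter w)"]) auto
qed

lemma mult_ball:
  assumes "g \<in> ball r" "h \<in> ball s"
  shows "g \<otimes> h \<in> ball (r + s)"
proof -
  obtain v w where "g \<in> carrier G" "length v \<le> r" "\<phi> g = act v"
      "h \<in> carrier G" "length w \<le> s" "\<phi> h = act w"
    using assms by (auto simp: ball_def)
  then show ?thesis
    unfolding ball_def by (intro CollectI conjI exI[of _ "v @ w"]) (auto simp: phi_mult)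
qed

lemma ball_split:
  assumes "g \<in> ball (r + s)"
  obtains g1 g2 where "g1 \<in> ball r" "g2 \<in> ball s" "g = g1 \<otimes> g2"
proof -
  obtain w where w: "g \<in> carrier G" "length w \<le> r + s" "\<phi> g = act w"
    using assms by (auto simp: ball_def)
  obtain g1 where g1: "g1 \<in> carrier G" "\<phi> g1 = act (take r w)" by (rule obtain_act)
  obtain g2 where g2: "g2 \<in> carrier G" "\<phi> g2 = act (drop r w)" by (rule obtain_act)
  have "\<phi> (g1 \<otimes> g2) = \<phi> g"
    using g1 g2 w(3) act_append[of "take r w" "drop r w"] by (simp add: phi_mult)
  then have "g = g1 \<otimes> g2"
    using inj_phi g1(1) g2(1) w(1) by (metis inj_onD m_closed)
  moreover have "g1 \<in> ball r" "g2 \<in> ball s"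
    unfolding ball_def using g1 g2 w(2)
    by (intro CollectI conjI exI[of _ "take r w"] exI[of _ "drop r w"]; simp)+
  ultimately show ?thesis
    using that by blast
qed

lemma one_in_ball: "\<one> \<in> ball r"
  using phi_one by (auto simp: ball_def intro!: exI[of _ "[]"])

lemma word_ball_eq_ball: "word_ball G (ball r) m = ball (r * m)"
proof
  have "foldr (\<otimes>) ws \<one> \<in> ball (r * m)" if "length ws \<le> m" "set ws \<subseteq> ball r" for ws m
    using that
  proof (induction ws arbitrary: m)
    case (Cons g ws)
    then obtain m' where m: "m = Suc m'" by (cases m) auto
    then show ?case
      using Cons mult_ball[of g r "foldr (\<otimes>) ws \<one>" "r * m'"] by simp
  qed (simp add: one_in_ball)
  then show "word_ball G (ball r) m \<subseteq> ball (r * m)"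
    using inv_ball by (auto simp: word_ball_def image_subset_iff Un_absorb2)
  have "\<exists>ws. g = foldr (\<otimes>) ws \<one> \<and> length ws = m \<and> set ws \<subseteq> ball r" if "g \<in> ball (r * m)" for g m
    using that
  proof (induction m arbitrary: g)
    case 0
    then have "\<phi> g = id" "g \<in> carrier G"
      by (auto simp: ball_def)
    then show ?case
      by (simp add: phi_eq_id_iff)
  next
    case (Suc m)
    then obtain g1 g2 where g: "g1 \<in> ball r" "g2 \<in> ball (r * m)" "g = g1 \<otimes> g2"
      using ball_split[of g r "r * m"] by auto
    then obtain ws where "g2 = foldr (\<otimes>) ws \<one>" "length ws = m" "set ws \<subseteq> ball r"
      using Suc.IH by blast
    then show ?case
      using g by (intro exI[of _ "g1 # ws"]) simp
  qed
  then show "ball (r * m) \<subseteq> word_ball G (ball r) m"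
    unfolding word_ball_def by blast
qed

lemma generate_ball:
  assumes "1 \<le> r"
  shows "generate G (ball r) = carrier G"
proof
  have sub: "ball r \<subseteq> carrier G"
    by (auto simp: ball_def)
  then show "generate G (ball r) \<subseteq> carrier G"
    by (rule generate_incl)
  have "g \<in> generate G (ball r)" if "g \<in> carrier G" "\<phi> g = act w" for g w
    using that
  proof (induction w arbitrary: g)
    case Nil
    then show ?case
      using phi_eq_id_iff[of g] by (simp only: act_Nil generate.one)
  next
    case (Cons l w)
    obtain g1 where g1: "g1 \<in> carrier G" "\<phi> g1 = act [l]" by (rule obtain_act)
    obtain g2 where g2: "g2 \<in> carrier G" "\<phi> g2 = act w" by (rule obtain_act)
    have "\<phi> (g1 \<otimes> g2) = \<phi> g"
      using g1 g2 Cons.prems by (simp only: phi_mult act_Cons act_Nil comp_id)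
    then have "g = g1 \<otimes> g2"
      using inj_phi g1(1) g2(1) Cons.prems(1) by (metis inj_onD m_closed)
    moreover have "g1 \<in> ball r"
      using g1 assms by (auto simp: ball_def intro!: exI[of _ "[l]"])
    ultimately show ?case
      using Cons.IH[OF g2] by (auto intro: generate.eng generate.incl)
  qed
  then show "carrier G \<subseteq> generate G (ball r)"
    using phi_image by blast
qed

end


section \<open>Realisation on the natural numbers\<close>

text \<open>An injective encoding transports composition to the naturals, giving the group a fixed
  carrier type.\<close>

lemma ex_nat_group:
  fixes P :: "('a \<Rightarrow> 'a) set"
  assumes "countable P" and id: "id \<in> P"
    and comp: "\<And>f g. f \<in> P \<Longrightarrow> g \<in> P \<Longrightarrow> f \<circ> g \<in> P"
    and inverse: "\<And>f. f \<in> P \<Longrightarrow> \<exists>g\<in>P. g \<circ> f = id"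
  obtains G :: "nat monoid" and \<phi> where "group G" "inj_on \<phi> (carrier G)" "\<phi> ` carrier G = P"
    "\<And>x y. x \<in> carrier G \<Longrightarrow> y \<in> carrier G \<Longrightarrow> \<phi> (x \<otimes>\<^bsub>G\<^esub> y) = \<phi> x \<circ> \<phi> y"
proof -
  obtain enc :: "('a \<Rightarrow> 'a) \<Rightarrow> nat" where enc: "inj_on enc P"
    using assms(1) by (auto simp: countable_def)
  define dec where "dec = inv_into P enc"
  define G where "G = \<lparr>carrier = enc ` P, mult = \<lambda>x y. enc (dec x \<circ> dec y), one = enc id\<rparr>"
  have dec: "dec (enc f) = f" if "f \<in> P" for f
    using enc that by (simp add: dec_def)
  have "group G"
  proof (rule groupI)
    show "\<exists>y\<in>carrier G. y \<otimes>\<^bsub>G\<^esub> x = \<one>\<^bsub>G\<^esub>" if "x \<in> carrier G" for x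
    proof -
      obtain f where f: "f \<in> P" "x = enc f"
        using \<open>x \<in> carrier G\<close> by (auto simp: G_def)
      moreover obtain g where "g \<in> P" "g \<circ> f = id"
        using inverse[OF f(1)] by blast
      ultimately show ?thesis
        by (intro bexI[of _ "enc g"]) (simp_all add: G_def dec)
    qed
  qed (auto simp: G_def dec id comp comp_assoc)
  then show ?thesis
    by (rule that[of G dec]) (auto simp: G_def dec comp inj_on_def image_image)
qed

lemma (in separated_lamp_family) ex_lamp_group: "\<exists>G \<phi>. lamp_group d n G \<phi>"
proof -
  have "countable (UNIV :: letter list set)"
    using countable_lists[OF countable_finite[OF finite_UNIV_letter]] by simp
  then have "countable (range act)"
    by (rule countable_image)
  moreover have "\<exists>g\<in>range act. g \<circ> f = id" if "f \<in> range act" for f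
  proof -
    obtain w where w: "f = act w"
      using \<open>f \<in> range act\<close> by blast
    let ?v = "rev (map inv_letter w)"
    have "inv_letter (inv_letter l) = l" for l
      by (cases l) auto
    then have "act ?v \<circ> f = id"
      using act_inv[of ?v] by (simp add: w rev_map o_def)
    then show ?thesis by blast
  qed
  moreover have "id \<in> range act"
    by (rule range_eqI[of _ _ "[]"]) simp
  moreover have "f \<circ> g \<in> range act" if "f \<in> range act" "g \<in> range act" for f g
  proof -
    obtain v w where "f = act v" "g = act w"
      using \<open>f \<in> range act\<close> \<open>g \<in> range act\<close> by blast
    then have "f \<circ> g = act (v @ w)"
      by simp
    then show ?thesis by blast
  qed
  ultimately obtain G :: "nat monoid" and \<phi> where "group G" "inj_on \<phi> (carrier G)"
      "\<phi> ` carrier G = range act"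
      "\<And>x y. x \<in> carrier G \<Longrightarrow> y \<in> carrier G \<Longrightarrow> \<phi> (x \<otimes>\<^bsub>G\<^esub> y) = \<phi> x \<circ> \<phi> y"
    using ex_nat_group[of "range act"] by metis
  then have "lamp_group d n G \<phi>"
    by (intro lamp_group.intro lamp_group_axioms.intro separated_lamp_family_axioms)
  then show ?thesis by blast
qed


section \<open>Growth\<close>

text \<open>Eventually \<open>ln n\<close> is at least \<open>b / c\<close> and the double logarithm
  at least \<open>1\<close>; from \<open>n = 3\<close> on the default factor \<open>0\<close> no
  longer interferes.\<close>

lemma n_log_n_growth_superlinear:
  fixes f :: "nat \<Rightarrow> nat" and c \<epsilon> :: real
  assumes "c > 0" "\<epsilon> > 0"
    and "\<And>n. n \<ge> 1 \<Longrightarrow> real (f n) \<ge> c * real n * ln (real n) *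
           (if n \<le> 2 then 0 else ln (ln (real n)) powr (1 + \<epsilon>))"
  shows "eventually (\<lambda>n. b * n \<le> f n) sequentially"
proof -
  have ln_top: "filterlim (\<lambda>n. ln (real n)) at_top sequentially"
    by (rule filterlim_compose[OF ln_at_top filterlim_real_sequentially])
  have "eventually (\<lambda>n. real b / c \<le> ln (real n)) sequentially"
    using ln_top by (simp add: filterlim_at_top)
  moreover have "eventually (\<lambda>n. 1 \<le> ln (real n)) sequentially"
    using ln_top by (simp add: filterlim_at_top)
  moreover have "eventually (\<lambda>n. 1 \<le> ln (ln (real n))) sequentially"
    using filterlim_compose[OF ln_at_top ln_top] by (simp add: filterlim_at_top)
  ultimately show ?thesis
    using eventually_ge_at_top[of 3]
  proof eventually_elim
    case (elim n)
    have "1 \<le> ln (ln (real n)) powr (1 + \<epsilon>)"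
      using elim(3) assms(2) by (intro ge_one_powr_ge_zero) auto
    moreover have "real b * real n \<le> c * real n * ln (real n)"
      using mult_right_mono[OF elim(1), of "c * real n"] assms(1) by (simp add: field_simps)
    ultimately have "real b * real n * 1 \<le> c * real n * ln (real n) * ln (ln (real n)) powr (1 + \<epsilon>)"
      using assms(1) elim(2) by (intro mult_mono[of "real b * real n"]) auto
    also have "\<dots> \<le> real (f n)"
      using assms(3)[of n] elim(4) by simp
    finally have "real (b * n) \<le> real (f n)"
      by simp
    then show ?case
      by (simp only: of_nat_le_iff)
  qed
qed

text \<open>Round \<open>C\<^sub>2\<close> up to \<open>K\<close> and iterate until
  \<open>C\<^sub>1 ^ m\<close> exceeds 4. This factor pays for the 4 in \<open>depth_le\<close> and
  for rounding \<open>f\<close> to powers of two.\<close>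

lemma dilation_power_of_two:
  fixes f :: "nat \<Rightarrow> nat" and C\<^sub>1 C\<^sub>2 :: real
  assumes mono: "mono_on {1..} f" and C: "C\<^sub>1 > 1" "C\<^sub>2 > 1"
    and dil: "\<And>n. n \<ge> 1 \<Longrightarrow> C\<^sub>1 * real (f n) \<le> real (at_real f (C\<^sub>2 * real n))"
  obtains c where "c \<ge> 1" "\<And>n. n \<ge> 1 \<Longrightarrow> 4 * f n \<le> f (2 ^ c * n)"
proof -
  define K where "K = nat \<lceil>C\<^sub>2\<rceil>"
  have K: "C\<^sub>2 \<le> real K" "K \<ge> 1"
    using C(2) by (auto simp: K_def) linarith
  have step: "C\<^sub>1 * real (f n) \<le> real (f (K * n))" if n: "n \<ge> 1" for n
  proof -
    have "C\<^sub>2 * real n \<le> real (K * n)"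
      using mult_right_mono[OF K(1), of "real n"] by simp
    then have "nat \<lceil>C\<^sub>2 * real n\<rceil> \<le> K * n"
      by (simp only: nat_le_iff ceiling_le_iff of_int_of_nat_eq)
    moreover have "nat \<lceil>C\<^sub>2 * real n\<rceil> \<ge> 1"
      using C(2) n mult_pos_pos[of C\<^sub>2 "real n"] by linarith
    ultimately have "at_real f (C\<^sub>2 * real n) \<le> f (K * n)"
      unfolding at_real_def using K(2) n by (intro mono_onD[OF mono]) auto
    then show ?thesis
      using dil[OF n] by linarith
  qed
  have iter: "C\<^sub>1 ^ m * real (f n) \<le> real (f (K ^ m * n))" if n: "n \<ge> 1" for m n
  proof (induction m)
    case (Suc m)
    have "C\<^sub>1 ^ Suc m * real (f n) \<le> C\<^sub>1 * real (f (K ^ m * n))"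
      using mult_left_mono[OF Suc, of C\<^sub>1] C(1) by (simp add: mult_ac)
    also have "\<dots> \<le> real (f (K ^ Suc m * n))"
      using step[of "K ^ m * n"] K(2) n by (simp add: mult_ac)
    finally show ?case .
  qed simp
  obtain m where m: "4 < C\<^sub>1 ^ m"
    using real_arch_pow[OF C(1)] by blast
  \<comment> \<open>A crude exponent with \<open>K ^ m \<le> 2 ^ c\<close>; \<open>Suc\<close> makes
    \<open>c \<ge> 1\<close> evident.\<close>
  define c where "c = Suc (K ^ m)"
  have "4 * f n \<le> f (2 ^ c * n)" if n: "n \<ge> 1" for n
  proof -
    have "real (4 * f n) \<le> C\<^sub>1 ^ m * real (f n)"
      using m by (simp add: mult_right_mono)
    then have "4 * f n \<le> f (K ^ m * n)"
      using iter[OF n, of m] by linarith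
    also have "\<dots> \<le> f (2 ^ c * n)"
    proof (rule mono_onD[OF mono])
      have "K ^ m \<le> 2 ^ c"
        using less_exp[of c] unfolding c_def by linarith
      then show "K ^ m * n \<le> 2 ^ c * n"
        by simp
      show "K ^ m * n \<in> {1..}" "2 ^ c * n \<in> {1..}"
        using K(2) n by simp_all
    qed
    finally show ?thesis .
  qed
  then show ?thesis
    using that[of c] by (simp add: c_def)
qed

lemma ex_power_of_two_between:
  assumes "(m::nat) \<ge> 1"
  shows "\<exists>e. 2 ^ e \<le> m \<and> m < 2 ^ Suc e"
  using ex_power_ivl1[of 2 m] assms by auto

theorem theorem1p3:
  fixes f :: "nat \<Rightarrow> nat"
  assumes f_pos: "\<And>n. n \<ge> 1 \<Longrightarrow> f n \<ge> 1"
    and f_mono: "mono_on {1..} f"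
    and growth: "\<exists>(c::real) \<epsilon>::real. c > 0 \<and> \<epsilon> > 0 \<and>
      (\<forall>n\<ge>1. real (f n) \<ge>
         c * real n * ln (real n) *
           (if n \<le> 2 then 0 else ln (ln (real n)) powr (1 + \<epsilon>)))"
    and dilation: "\<exists>(C\<^sub>1::real) C\<^sub>2::real. C\<^sub>1 > 1 \<and> C\<^sub>2 > 1 \<and>
      (\<forall>n\<ge>1. C\<^sub>1 * real (f n) \<le> real (at_real f (C\<^sub>2 * real n)))"
  shows "\<exists>(G :: nat monoid) S (K\<^sub>1::real) K\<^sub>2::real.
      group G \<and> residually_finite G \<and>
      finite S \<and> S \<subseteq> carrier G \<and> generate G S = carrier G \<and>
      K\<^sub>1 > 0 \<and> K\<^sub>2 > 0 \<and>
      (\<forall>n\<ge>1. at_real f (K\<^sub>1 * real n) \<le> divisibility_fun G S n \<and>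
              divisibility_fun G S n \<le> at_real f (K\<^sub>2 * real n))"
proof -
  obtain c where c: "c \<ge> 1" and dil: "\<And>n. n \<ge> 1 \<Longrightarrow> 4 * f n \<le> f (2 ^ c * n)"
    using dilation dilation_power_of_two[OF f_mono] by metis
  have "eventually (\<lambda>n. 2 * n \<le> f n) sequentially"
    using growth n_log_n_growth_superlinear by metis
  then obtain N where N: "\<And>n. n \<ge> N \<Longrightarrow> 2 * n \<le> f n"
    unfolding eventually_sequentially by blast
  have mono: "f m \<le> f n" if "1 \<le> m" "m \<le> n" for m n
    using that by (intro mono_onD[OF f_mono]) auto

  \<comment> \<open>Sites and cycle lengths\<close>
  define C :: nat where "C = 2 ^ c"
  \<comment> \<open>The shift pushes all sites beyond \<open>N\<close>; its \<open>Suc\<close>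
    leaves one spare factor \<open>C\<close> for the dilation in the lower bound.\<close>
  define s where "s = Suc N"
  define site where "site i = C ^ (i + s)" for i
  have C2: "2 \<le> C"
    unfolding C_def using c power_increasing[of 1 c "2::nat"] by simp
  have site_ge: "N \<le> site i" "2 \<le> site i" for i
  proof -
    have "i + s < C ^ (i + s)"
      using C2 by (intro power_gt_expt) auto
    then show "N \<le> site i" "2 \<le> site i"
      unfolding site_def s_def by linarith+
  qed
  have site_eq: "site i = 2 ^ (c * (i + s))" for i
    by (simp add: site_def C_def power_mult)
  have site_mono: "site i \<le> site k" if "i \<le> k" for i k
    unfolding site_def using that C2 by (intro power_increasing) auto
  have "\<exists>e. 2 ^ e \<le> f (site i) \<and> f (site i) < 2 ^ Suc e" for i
    using site_ge[of i] f_pos[of "site i"] by (intro ex_power_of_two_between) auto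
  then obtain e where e: "\<And>i. 2 ^ e i \<le> f (site i)" "\<And>i. f (site i) < 2 ^ Suc (e i)"
    by metis
  \<comment> \<open>Both sides are powers of two, so the strict bound passes to exponents; it yields
    \<open>2 * n i \<le> d i\<close> and \<open>e i \<ge> 1\<close>.\<close>
  have e_gt: "c * (i + s) < e i" for i
  proof -
    have "2 * site i < 2 ^ Suc (e i)"
      using N[OF site_ge(1), of i] e(2)[of i] by linarith
    then have "(2::nat) ^ Suc (c * (i + s)) < 2 ^ Suc (e i)"
      by (simp add: site_eq)
    then show ?thesis
      by (simp del: power_Suc)
  qed
  have e_mono: "e i \<le> e k" if "i \<le> k" for i k
  proof -
    have "f (site i) \<le> f (site k)"
      using site_mono[OF that] site_ge(2)[of i] by (intro mono) auto
    then have "(2::nat) ^ e i < 2 ^ Suc (e k)"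
      using e(1)[of i] e(2)[of k] by linarith
    then show ?thesis
      by (simp del: power_Suc)
  qed

  define n where "n i = int (site i)" for i
  define d where "d i = (2::int) ^ e i" for i
  have d_ge: "2 * n i \<le> d i" for i
    using power_increasing[of "Suc (c * (i + s))" "e i" "2::int"] e_gt[of i]
    by (simp add: n_def d_def site_eq)

  \<comment> \<open>Separation of the sites\<close>
  interpret separated_lamp_family d n
  proof
    show "0 < d k" "0 \<le> n k" for k
      by (simp_all add: d_def n_def)
    show "\<not> d k dvd n i - n k" if "i \<noteq> k" for i k
    proof (cases "i < k")
      case True
      have "site i < site k"
        unfolding site_def using True C2 by (intro power_strict_increasing) auto
      moreover have "n k < d k"
        using d_ge[of k] site_ge(2)[of k] by (simp add: n_def)
      ultimately have "0 < n k - n i" "n k - n i < d k"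
        by (simp_all add: n_def)
      then have "\<not> d k dvd n k - n i"
        using zdvd_not_zless by blast
      then show ?thesis
        by (simp add: dvd_diff_commute)
    next
      case False
      then have "k < i"
        using that by simp
      \<comment> \<open>Twice \<open>n k\<close> is a power of two dividing both \<open>n i\<close>
        and \<open>d k\<close>, but not \<open>n k\<close>.\<close>
      then have "c * (k + s) + 1 \<le> c * (i + s)"
        using c by (metis Suc_eq_plus1 Suc_leI add_less_mono1 mult_less_mono2 less_le_trans zero_less_one)
      then have "(2::int) ^ (c * (k + s) + 1) dvd n i"
        by (simp only: n_def site_eq of_nat_power of_nat_numeral le_imp_power_dvd)
      moreover have "(2::int) ^ (c * (k + s) + 1) dvd d k"
        unfolding d_def using e_gt[of k] by (intro le_imp_power_dvd) simp
      moreover have "\<not> (2::int) ^ (c * (k + s) + 1) dvd n k"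
        by (simp add: n_def site_eq power_dvd_imp_le)
      ultimately show ?thesis
        by (metis dvd_diff_right_iff dvd_trans)
    qed
  qed

  \<comment> \<open>The group and its word balls\<close>
  obtain G \<phi> where "lamp_group d n G \<phi>"
    using ex_lamp_group by blast
  then interpret lamp_group d n G \<phi> .

  \<comment> \<open>Probe words have length \<open>8 * site i + 10\<close>, at most
    \<open>18 * site i = r * C ^ i\<close>.\<close>
  define r where "r = 18 * site 0"
  define D where "D = divisibility_fun G (ball r)"
  define W where "W m = ball (r * m) - {\<one>\<^bsub>G\<^esub>}" for m
  have D: "D m = Max (depth G ` W m)" and fin: "finite (W m)" for m
    by (simp_all add: D_def divisibility_fun_def word_ball_eq_ball W_def finite_ball)
  have C_pow: "C ^ (i + s) = C ^ i * site 0" for i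
    by (simp add: site_def power_add)
  have probe: "\<exists>w\<in>W m. 2 ^ e i \<le> depth G w" if "C ^ i \<le> m" for i m
  proof -
    obtain w where w: "w \<in> carrier G" "\<phi> w = act (probe_word i)" by (rule obtain_act)
    have "length (probe_word i) \<le> 18 * site i"
      using site_ge(2)[of i] by (simp add: length_probe_word n_def)
    also have "\<dots> = r * C ^ i"
      by (simp add: r_def site_def power_add)
    also have "\<dots> \<le> r * m"
      using that by simp
    finally have "w \<in> ball (r * m)"
      using w by (auto simp: ball_def)
    moreover have "w \<noteq> \<one>\<^bsub>G\<^esub>"
      using w(2) probe_word_nontrivial[of i] phi_one by metis
    moreover have "2 ^ e i \<le> depth G w"
      using e_gt[of i] w by (intro depth_probe_ge[of i]) (simp_all add: d_def)
    ultimately show ?thesis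
      by (auto simp: W_def)
  qed

  \<comment> \<open>Lower bound\<close>
  have lower: "at_real f (1 / real C * real m) \<le> D m" if m: "m \<ge> 1" for m
  proof -
    obtain i where i: "C ^ i \<le> m" "m < C ^ Suc i"
      using ex_power_ivl1[of C m] C2 m by auto
    obtain w where w: "w \<in> W m" "2 ^ e i \<le> depth G w"
      using probe[OF i(1)] by blast
    have "1 / real C * real m \<le> real (C ^ i)"
    proof -
      have "real m \<le> real (C * C ^ i)"
        using i(2) by (simp only: of_nat_le_iff power_Suc)
      then show ?thesis
        using C2 by (simp add: field_simps)
    qed
    then have below: "nat \<lceil>1 / real C * real m\<rceil> \<le> C ^ i"
      by (simp only: nat_le_iff ceiling_le_iff of_int_of_nat_eq)
    have "0 < 1 / real C * real m"
      using C2 m by simp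
    then have "1 \<le> nat \<lceil>1 / real C * real m\<rceil>"
      by linarith
    moreover have "nat \<lceil>1 / real C * real m\<rceil> \<le> C ^ (i + N)"
      using C2 by (intro order.trans[OF below] power_increasing) auto
    ultimately have "at_real f (1 / real C * real m) \<le> f (C ^ (i + N))"
      unfolding at_real_def by (rule mono)
    \<comment> \<open>\<open>site i\<close> is \<open>C\<close> times \<open>C ^ (i + N)\<close>, so
      one dilation absorbs the loss from rounding \<open>f (site i)\<close> down to
      \<open>2 ^ e i\<close>.\<close>
    also have "\<dots> \<le> 2 ^ e i"
    proof -
      have "4 * f (C ^ (i + N)) \<le> f (site i)"
        using dil[of "C ^ (i + N)"] C2 by (simp add: C_def[symmetric] site_def s_def)
      then show ?thesis
        using e(2)[of i] by simp
    qed
    also have "\<dots> \<le> depth G w"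
      by (rule w(2))
    also have "\<dots> \<le> D m"
      unfolding D using w(1) fin by (intro Max_ge) auto
    finally show ?thesis .
  qed

  \<comment> \<open>Upper bound\<close>
  have upper: "D m \<le> at_real f (real (36 * C ^ 2 * site 0) * real m)" if m: "m \<ge> 1" for m
  proof -
    \<comment> \<open>\<open>36\<close> is twice the \<open>18\<close> in \<open>r\<close>: site
      \<open>Suc i\<close> then exceeds twice the word length plus one.\<close>
    obtain i where i: "C ^ i \<le> 36 * m" "36 * m < C ^ Suc i"
      using ex_power_ivl1[of C "36 * m"] C2 m by auto
    define l where "l = Suc i"
    have "(36 * m + 1) * site 0 \<le> C ^ l * site 0"
      using i(2) by (intro mult_le_mono1) (simp add: l_def)
    then have far: "2 * (r * m) + 1 < site l"
      using site_ge(2)[of 0] by (simp add: r_def site_def power_add algebra_simps)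
    have "depth G g \<le> 4 * 2 ^ e l" if "g \<in> W m" for g
    proof -
      obtain w where w: "g \<in> carrier G" "g \<noteq> \<one>\<^bsub>G\<^esub>" "length w \<le> r * m" "\<phi> g = act w"
        using \<open>g \<in> W m\<close> by (auto simp: W_def ball_def)
      have "depth G g \<le> 4 * nat (d l)"
      proof (rule depth_le_of_short[OF w(1,2,4)])
        show "2 * int (length w) + 1 < n l"
          using w(3) far by (simp add: n_def)
        show "mono n"
          using site_mono by (auto simp: mono_def n_def)
      qed (use d_ge e_mono in \<open>auto simp: d_def\<close>)
      then show ?thesis
        by (simp add: d_def nat_power_eq)
    qed
    \<comment> \<open>Over an empty set \<open>Max\<close> would be unspecified.\<close>
    moreover have "W m \<noteq> {}"
      using probe[of 0 m] m by auto
    ultimately have "D m \<le> 4 * 2 ^ e l"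
      unfolding D using fin by (intro Max.boundedI) auto
    also have "\<dots> \<le> 4 * f (site l)"
      using e(1) by simp
    \<comment> \<open>This dilation absorbs the 4; together with \<open>l = Suc i\<close> it
      accounts for \<open>C ^ 2\<close> in the constant.\<close>
    also have "\<dots> \<le> f (C * site l)"
      using dil[of "site l"] site_ge(2)[of l] by (simp add: C_def)
    also have "\<dots> \<le> f (36 * C ^ 2 * site 0 * m)"
    proof (rule mono)
      have "C * site l = C ^ i * (C ^ 2 * site 0)"
        by (simp add: l_def site_def power_add power2_eq_square)
      also have "\<dots> \<le> (36 * m) * (C ^ 2 * site 0)"
        using i(1) by (rule mult_le_mono1)
      finally show "C * site l \<le> 36 * C ^ 2 * site 0 * m"
        by (simp add: mult_ac)
      show "1 \<le> C * site l"
        using C2 site_ge(2)[of l] by simp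
    qed
    also have "\<dots> = at_real f (real (36 * C ^ 2 * site 0) * real m)"
      unfolding at_real_def by (metis ceiling_of_nat nat_int of_nat_mult)
    finally show ?thesis .
  qed

  have "1 \<le> r"
    using site_ge(2)[of 0] by (simp add: r_def)
  then show ?thesis
    using residually_finite finite_ball generate_ball lower upper C2 site_ge(2)[of 0] is_group
    by (intro exI[of _ G] exI[of _ "ball r"] exI[of _ "1 / real C"]
        exI[of _ "real (36 * C ^ 2 * site 0)"]) (auto simp: D_def ball_def)
qed

end
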